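(* Let $G$ be the Steiner graph of a $2$-$(v,k,1)$ design. Then the VC-dimension of $G$ is at most $k(k+1)$.
   Context: All graphs are finite and simple. A $2$-$(v,k,1)$ design is a pair $(\mathcal P,\mathcal B)$ of sets (points and blocks), with $\mathcal B\subseteq 2^{\mathcal P}$, such that $|\mathcal P|=v$, $|B|=k$ for all $B\in\mathcal B$, and for any distinct $p,q\in\mathcal P$ there is a unique $B\in\mathcal B$ with $p,q\in B$. Its Steiner graph has vertex set $\mathcal B$, and two distinct blocks $B,C$ are adjacent if and only if $B\cap C\neq\emptyset$. The VC-dimension of a graph $G$ is the maximum size of a set $S\subseteq V(G)$ that is shattered, meaning that for every $A\subseteq S$ there is a vertex $u\in V(G)$ (possibly $u\in S$) with $N(u)\cap S=A$, where $N(u)$ is the open neighborhood of $u$. *)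

theory Defs
  imports Complex_Main "Graph_Theory.Pair_Digraph"
begin

text \<open>A 2-$(v,k,1)$ design. Finiteness of \<open>P\<close> is listed explicitly because \<open>card\<close> is \<open>0\<close> on
  infinite sets; finiteness of \<open>Bs\<close> and of each block then follows from \<open>Bs \<subseteq> Pow P\<close>.\<close>

definition two_design :: "'a set \<Rightarrow> 'a set set \<Rightarrow> nat \<Rightarrow> nat \<Rightarrow> bool" where
  "two_design P Bs v k \<longleftrightarrow>
     finite P \<and> card P = v \<and>
     Bs \<subseteq> Pow P \<and> (\<forall>B\<in>Bs. card B = k) \<and>
     (\<forall>p\<in>P. \<forall>q\<in>P. p \<noteq> q \<longrightarrow> (\<exists>!B. B \<in> Bs \<and> p \<in> B \<and> q \<in> B))"

text \<open>Finite simple graphs are represented, as usual in this library, by finite loop-free symmetric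
  digraphs without parallel arcs (locale \<open>pair_graph\<close>).\<close>

definition steiner_graph :: "'a set set \<Rightarrow> 'a set pair_pre_digraph" where
  "steiner_graph Bs =
     \<lparr> pverts = Bs, parcs = {(B, C). B \<in> Bs \<and> C \<in> Bs \<and> B \<noteq> C \<and> B \<inter> C \<noteq> {}} \<rparr>"

definition neighborhood :: "'a pair_pre_digraph \<Rightarrow> 'a \<Rightarrow> 'a set" where
  "neighborhood G u = {w. u \<rightarrow>\<^bsub>with_proj G\<^esub> w}"

definition shattered :: "'a pair_pre_digraph \<Rightarrow> 'a set \<Rightarrow> bool" where
  "shattered G S \<longleftrightarrow>
     S \<subseteq> pverts G \<and> (\<forall>A. A \<subseteq> S \<longrightarrow> (\<exists>u \<in> pverts G. neighborhood G u \<inter> S = A))"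

text \<open>On \<open>nat\<close>, \<open>Sup\<close> of a finite non-empty set is its maximum and \<open>Sup {} = 0\<close>. The empty set of
  vertices is shattered as soon as \<open>G\<close> has a vertex, so for finite \<open>G\<close> the value \<open>Sup {}\<close> is only
  used for the graph without vertices.\<close>

definition vc_dim :: "'a pair_pre_digraph \<Rightarrow> nat" where
  "vc_dim G = Sup {card S | S. shattered G S}"

lemma pair_graph_steiner_graph:
  assumes "two_design P Bs v k"
  shows "pair_graph (steiner_graph Bs)"
proof -
  have fin: "finite Bs"
    using assms finite_subset[of Bs "Pow P"] by (auto simp: two_design_def)
  have "finite (parcs (steiner_graph Bs))"
    by (rule finite_subset[of _ "Bs \<times> Bs"]) (auto simp: steiner_graph_def fin)
  then show ?thesis
    by unfold_locales (auto simp: steiner_graph_def fin symmetric_def intro!: symI)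
qed

lemma vc_dim_maximum:
  assumes "finite (pverts G)" and "pverts G \<noteq> {}"
  shows "\<exists>S. shattered G S \<and> card S = vc_dim G"
    and "\<And>S. shattered G S \<Longrightarrow> card S \<le> vc_dim G"
proof -
  let ?X = "{card S | S. shattered G S}"
  have "?X \<subseteq> card ` Pow (pverts G)" by (auto simp: shattered_def)
  then have fin: "finite ?X" using assms(1) by (meson finite_Pow_iff finite_imageI finite_subset)
  have "shattered G {}" using assms(2) by (auto simp: shattered_def)
  then have ne: "?X \<noteq> {}" by auto
  have eq: "vc_dim G = Max ?X" using ne by (simp only: vc_dim_def Sup_nat_def if_False)
  show "\<exists>S. shattered G S \<and> card S = vc_dim G" using Max_in[OF fin ne] unfolding eq by auto
  show "card S \<le> vc_dim G" if "shattered G S" for S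
    unfolding eq using that by (intro Max_ge[OF fin]) auto
qed

end

(* Some block u meets every block of a shattered set S, so it suffices to bound, for each point p of u,
   the number of members of S through p. Let T be the set of these members. A block missing p meets
   at most k blocks through p, as these are disjoint away from p; a block containing p is adjacent to
   every member of T except possibly itself. Hence if more than k members of T lie in a subset A of S,
   but not all do, then only a block x with T - A = {x} can realise A. If T has at least k + 2
   elements, then T - {x} and S - {x} are both realised by x only, which forces S = T; and then
   removing two blocks from S gives a contradiction unless S has k + 2 elements. *)
theory Submission
  imports Defs
begin

lemma neighborhood_steiner_graph:
  "neighborhood (steiner_graph Bs) u = {w. u \<in> Bs \<and> w \<in> Bs \<and> u \<noteq> w \<and> u \<inter> w \<noteq> {}}"
  by (auto simp: neighborhood_def steiner_graph_def arcs_ends_conv with_proj_def)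

lemma shattered_steiner_graph:
  "shattered (steiner_graph Bs) S \<longleftrightarrow>
     S \<subseteq> Bs \<and> (\<forall>A. A \<subseteq> S \<longrightarrow> (\<exists>u\<in>Bs. neighborhood (steiner_graph Bs) u \<inter> S = A))"
  by (simp add: shattered_def steiner_graph_def)

lemma two_design_finite:
  assumes "two_design P Bs v k"
  shows "finite Bs" and "B \<in> Bs \<Longrightarrow> finite B"
  using assms finite_subset[of Bs "Pow P"] finite_subset[of B P] by (auto simp: two_design_def)

lemma two_design_block_eq:
  assumes "two_design P Bs v k" "B \<in> Bs" "C \<in> Bs" "p \<in> B" "p \<in> C" "q \<in> B" "q \<in> C" "p \<noteq> q"
  shows "B = C"
proof -
  have "p \<in> P" "q \<in> P"
    using assms by (auto simp: two_design_def)
  then have "\<exists>!B. B \<in> Bs \<and> p \<in> B \<and> q \<in> B"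
    using assms(1,8) by (simp add: two_design_def)
  then show ?thesis
    using assms(2-7) by blast
qed

text \<open>Choosing a point of \<open>w\<close> on each block of \<open>X\<close> is injective: a
  chosen point differs from \<open>p\<close>, so two blocks with the same choice share two points
  and coincide.\<close>

lemma card_blocks_through_point_meeting_block_le:
  assumes D: "two_design P Bs v k" and "w \<in> Bs" "p \<notin> w"
    and X: "X \<subseteq> Bs" "\<And>B. B \<in> X \<Longrightarrow> p \<in> B" "\<And>B. B \<in> X \<Longrightarrow> w \<inter> B \<noteq> {}"
  shows "card X \<le> k"
proof -
  have "\<forall>B\<in>X. \<exists>q. q \<in> w \<inter> B"
    using X(3) by blast
  then obtain f where f: "\<And>B. B \<in> X \<Longrightarrow> f B \<in> w \<inter> B"
    by metis
  have "inj_on f X"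
  proof (rule inj_onI)
    fix B C assume BC: "B \<in> X" "C \<in> X" "f B = f C"
    show "B = C"
    proof (rule two_design_block_eq[OF D])
      show "p \<noteq> f B"
        using f[OF BC(1)] \<open>p \<notin> w\<close> by auto
    qed (use BC f[OF BC(1)] f[OF BC(2)] X in auto)
  qed
  moreover have "f ` X \<subseteq> w"
    using f by auto
  ultimately have "card X \<le> card w"
    using two_design_finite(2)[OF D \<open>w \<in> Bs\<close>] by (rule card_inj_on_le)
  then show ?thesis
    using D \<open>w \<in> Bs\<close> by (simp add: two_design_def)
qed

text \<open>A block \<open>w\<close> realising \<open>A\<close> meets more than \<open>k\<close>
  blocks through \<open>p\<close>, so it cannot miss \<open>p\<close>.\<close>

lemma shattered_trace_pencil:
  assumes D: "two_design P Bs v k" and S: "shattered (steiner_graph Bs) S"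
    and "A \<subseteq> S" and T: "T = {B \<in> S. p \<in> B}" and "card (A \<inter> T) > k" and "\<not> T \<subseteq> A"
  shows "\<exists>x. T - A = {x} \<and> neighborhood (steiner_graph Bs) x \<inter> S = A"
proof -
  have SB: "S \<subseteq> Bs"
    using S by (simp add: shattered_steiner_graph)
  obtain w where w: "w \<in> Bs" "neighborhood (steiner_graph Bs) w \<inter> S = A"
    using S \<open>A \<subseteq> S\<close> shattered_steiner_graph by metis
  have "p \<in> w"
  proof (rule ccontr)
    assume "p \<notin> w"
    have "card (A \<inter> T) \<le> k"
    proof (rule card_blocks_through_point_meeting_block_le[OF D \<open>w \<in> Bs\<close> \<open>p \<notin> w\<close>])
      show "w \<inter> B \<noteq> {}" if "B \<in> A \<inter> T" for B
        using that w(2) unfolding neighborhood_steiner_graph by blast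
    qed (use SB T in auto)
    then show False
      using \<open>card (A \<inter> T) > k\<close> by simp
  qed
  \<comment> \<open>Both \<open>B\<close> and \<open>w\<close> contain \<open>p\<close>, so they are
    adjacent unless equal. Hence \<open>w\<close> is the only member of \<open>T\<close> that
    \<open>A\<close> can omit.\<close>
  then have "B \<in> A" if "B \<in> T" "B \<noteq> w" for B
    using that T SB w unfolding neighborhood_steiner_graph by blast
  then have "T - A = {w}"
    using \<open>\<not> T \<subseteq> A\<close> by blast
  then show ?thesis
    using w(2) by blast
qed

lemma card_shattered_pencil_le:
  assumes D: "two_design P Bs v k" and S: "shattered (steiner_graph Bs) S" and "card S > k + 2"
  shows "card {B \<in> S. p \<in> B} \<le> k + 1"
proof (rule ccontr)
  define T where "T = {B \<in> S. p \<in> B}"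
  assume "\<not> card {B \<in> S. p \<in> B} \<le> k + 1"
  then have T: "card T \<ge> k + 2"
    by (simp add: T_def)
  have TS: "T \<subseteq> S"
    by (auto simp: T_def)
  have fin: "finite S"
    using \<open>card S > k + 2\<close> card.infinite by fastforce
  then have finT: "finite T"
    using TS by (rule rev_finite_subset)
  note trace = shattered_trace_pencil[OF D S _ T_def]
  obtain x where x: "x \<in> T"
    using T by fastforce
  have cx: "card (T - {x}) > k"
    using T x finT by simp
  have "(T - {x}) \<inter> T = T - {x}" "(S - {x}) \<inter> T = T - {x}"
    using TS by auto
  then have c1: "card ((T - {x}) \<inter> T) > k" and c2: "card ((S - {x}) \<inter> T) > k"
    using cx by metis+
  have "T - {x} \<subseteq> S" "\<not> T \<subseteq> T - {x}"
    using x TS by auto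
  from trace[OF this(1) c1 this(2)]
  obtain y where y: "T - (T - {x}) = {y}" and Ny: "neighborhood (steiner_graph Bs) y \<inter> S = T - {x}"
    by blast
  have "S - {x} \<subseteq> S" "\<not> T \<subseteq> S - {x}"
    using x TS by auto
  from trace[OF this(1) c2 this(2)]
  obtain z where z: "T - (S - {x}) = {z}" and Nz: "neighborhood (steiner_graph Bs) z \<inter> S = S - {x}"
    by blast
  \<comment> \<open>Both differences are \<open>{x}\<close>, so the single block \<open>x\<close>
    has both \<open>T - {x}\<close> and \<open>S - {x}\<close> as its trace on
    \<open>S\<close>.\<close>
  have "y = x" "z = x"
    using x TS y z by auto
  then have "S = T"
    using Ny Nz x TS by blast
  \<comment> \<open>Since \<open>S = T\<close>, the pencil now has at least \<open>k + 3\<close>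
    blocks, so more than \<open>k\<close> remain after two are removed.\<close>
  then have "card (T - {x}) > k + 1"
    using \<open>card S > k + 2\<close> x finT by simp
  then have "T - {x} \<noteq> {}"
    by (metis card.empty not_less_zero)
  then obtain y where y: "y \<in> T" "y \<noteq> x"
    by blast
  then have "card (T - {x} - {y}) > k"
    using \<open>card (T - {x}) > k + 1\<close> finT by simp
  moreover have "(T - {x} - {y}) \<inter> T = T - {x} - {y}"
    by auto
  ultimately have c3: "card ((T - {x} - {y}) \<inter> T) > k"
    by metis
  have "T - {x} - {y} \<subseteq> S" "\<not> T \<subseteq> T - {x} - {y}"
    using x TS by auto
  \<comment> \<open>The difference contains both \<open>x\<close> and \<open>y\<close>, so it is not
    a singleton.\<close>
  from trace[OF this(1) c3 this(2)] obtain z where "T - (T - {x} - {y}) = {z}"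
    by blast
  then show False
    using x y by blast
qed

text \<open>The \<open>k\<close> points of a block adjacent to all of \<open>S\<close> give
  \<open>k\<close> pencils that cover \<open>S\<close>, each with at most \<open>k + 1\<close>
  members in \<open>S\<close>.\<close>

lemma card_shattered_steiner_graph_le:
  assumes D: "two_design P Bs v k" and S: "shattered (steiner_graph Bs) S"
  shows "card S \<le> k * (k + 1)"
proof (rule ccontr)
  assume large: "\<not> card S \<le> k * (k + 1)"
  have SB: "S \<subseteq> Bs"
    using S by (simp add: shattered_steiner_graph)
  obtain u where u: "u \<in> Bs" "neighborhood (steiner_graph Bs) u \<inter> S = S"
    using S by (auto simp: shattered_steiner_graph)
  have adj: "u \<noteq> B \<and> u \<inter> B \<noteq> {}" if "B \<in> S" for B
    using that u(2) unfolding neighborhood_steiner_graph by blast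
  have fu: "finite u" and cu: "card u = k"
    using D u(1) two_design_finite(2)[OF D] by (auto simp: two_design_def)
  have "S \<noteq> {}"
    using large by auto
  then obtain B where B: "B \<in> S"
    by blast
  then have "card B = k"
    using D SB by (auto simp: two_design_def)
  \<comment> \<open>The blocks \<open>u\<close> and \<open>B\<close> are distinct but meet, which is
    impossible for blocks of size at most 1.\<close>
  have "k \<ge> 2"
  proof (rule ccontr)
    assume "\<not> k \<ge> 2"
    then consider "k = 0" | "k = 1"
      by linarith
    then show False
    proof cases
      case 1
      then show False
        using cu fu adj[OF B] by auto
    next
      case 2
      then obtain a b where "u = {a}" "B = {b}"
        using cu \<open>card B = k\<close> card_1_singletonE by metis
      then show False
        using adj[OF B] by auto
    qed
  qed
  \<comment> \<open>The assumed failure of the bound thus makes \<open>S\<close> large enough for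
    the pencil bound, as \<open>k + 2 \<le> 2 * (k + 1)\<close>.\<close>
  then have "2 * (k + 1) \<le> k * (k + 1)"
    by (rule mult_right_mono) simp
  also have "\<dots> < card S"
    using large by simp
  finally have "card S > k + 2"
    by simp
  note pencil = card_shattered_pencil_le[OF D S this]
  have "S = (\<Union>p\<in>u. {B \<in> S. p \<in> B})"
    using adj by blast
  then have "card S \<le> (\<Sum>p\<in>u. card {B \<in> S. p \<in> B})"
    using card_UN_le[OF fu] by metis
  also have "\<dots> \<le> k * (k + 1)"
    using sum_bounded_above[of u "\<lambda>p. card {B \<in> S. p \<in> B}" "k + 1"] pencil cu by simp
  finally show False
    using large by simp
qed

theorem theorem39:
  fixes P :: "'a set" and Bs :: "'a set set" and v k :: nat
  assumes "two_design P Bs v k"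
  shows "vc_dim (steiner_graph Bs) \<le> k * (k + 1)"
proof (cases "Bs = {}")
  case True
  \<comment> \<open>Without vertices not even the empty set is shattered, so the dimension is the
    default value \<open>Sup {} = 0\<close>.\<close>
  then have "{card S | S. shattered (steiner_graph Bs) S} = {}"
    by (auto simp: shattered_def steiner_graph_def)
  then show ?thesis
    by (simp add: vc_dim_def)
next
  case False
  then obtain S where "shattered (steiner_graph Bs) S" "card S = vc_dim (steiner_graph Bs)"
    using vc_dim_maximum(1)[of "steiner_graph Bs"] two_design_finite(1)[OF assms]
    by (auto simp: steiner_graph_def)
  then show ?thesis
    using card_shattered_steiner_graph_le[OF assms] by metis
qed

end
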